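(* Let $G$ be a simple graph on $n$ vertices with maximum degree $\Delta$ and clique number $\omega$, and let $\alpha \in [0,1]$. Then $$\lambda_1(A_\alpha(G)) \le \alpha\Delta + (1-\alpha)\left(1 - \frac{1}{\omega}\right)n.$$
   Context: For a simple graph $G$ with adjacency matrix $A(G)$ and diagonal degree matrix $D(G)$, and $\alpha\in[0,1]$, define $A_\alpha(G) = \alpha D(G) + (1-\alpha)A(G)$, with eigenvalues ordered $\lambda_1(A_\alpha(G)) \ge \dots \ge \lambda_n(A_\alpha(G))$. The clique number $\omega$ is the maximum number of vertices of a complete subgraph of $G$. *)

theory Defs
  imports
    "Graph_Theory.Digraph"
    "Graph_Theory.Digraph_Component"
    "Graph_Theory.Kuratowski"
    "Jordan_Normal_Form.Char_Poly"
    "HOL-Library.Multiset"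
begin

text \<open>
  A finite simple graph is a \<^term>\<open>G\<close> with \<^prop>\<open>graph G\<close>: every edge \<open>uv\<close> is represented by
  exactly the two arcs from \<open>u\<close> to \<open>v\<close> and from \<open>v\<close> to \<open>u\<close>, so \<^term>\<open>out_degree G v\<close> is the
  degree of \<open>v\<close>. Matrices are indexed by \<open>{0..<n}\<close>; the list \<open>vs\<close> is the ordering of the
  vertices by which rows and columns are labelled.
\<close>

definition max_degree :: "('a, 'b) pre_digraph \<Rightarrow> nat" where
  "max_degree G = Max (out_degree G ` verts G)"

definition clique_number :: "('a, 'b) pre_digraph \<Rightarrow> nat" where
  "clique_number G = Max {k. \<exists>H. subgraph H G \<and> complete_digraph k H}"

definition adjacency_mat :: "('a, 'b) pre_digraph \<Rightarrow> 'a list \<Rightarrow> real mat" where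
  "adjacency_mat G vs =
     mat (length vs) (length vs) (\<lambda>(i, j). if (vs ! i, vs ! j) \<in> arcs_ends G then 1 else 0)"

definition degree_mat :: "('a, 'b) pre_digraph \<Rightarrow> 'a list \<Rightarrow> real mat" where
  "degree_mat G vs = mat_diag (length vs) (\<lambda>i. real (out_degree G (vs ! i)))"

definition A_alpha :: "real \<Rightarrow> ('a, 'b) pre_digraph \<Rightarrow> 'a list \<Rightarrow> real mat" where
  "A_alpha \<alpha> G vs = \<alpha> \<cdot>\<^sub>m degree_mat G vs + (1 - \<alpha>) \<cdot>\<^sub>m adjacency_mat G vs"

text \<open>
  The real eigenvalues in non-increasing order, repeated according to algebraic multiplicity.
  For a real symmetric matrix of order \<open>n\<close> these are all \<open>n\<close> eigenvalues. The index \<open>k\<close> of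
  \<open>eigval k A\<close> starts at 1.
\<close>

definition eigvals_desc :: "real mat \<Rightarrow> real list" where
  "eigvals_desc A = rev (sorted_list_of_multiset (proots (char_poly A)))"

definition eigval :: "nat \<Rightarrow> real mat \<Rightarrow> real" where
  "eigval k A = eigvals_desc A ! (k - 1)"

end

theory Submission
  imports Defs "Jordan_Normal_Form.Spectral_Radius" "HOL-Analysis.Convex"
begin

text \<open>
  If \<open>x\<close> is an eigenvector for \<open>\<lambda>\<^sub>1\<close>, then \<open>\<lambda>\<^sub>1 |x|\<^sup>2 = x\<^sup>T A\<^sub>\<alpha> x\<close>. The degree part is at most
  \<open>\<alpha> \<Delta> |x|\<^sup>2\<close>. For the adjacency part replace \<open>x\<close> by its entrywise absolute value \<open>y\<close>; the
  Motzkin--Straus inequality \<open>y\<^sup>T A y \<le> (1 - 1/\<omega>) (\<Sum> y)\<^sup>2\<close> and Cauchy--Schwarz finish the proof.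
  Motzkin--Straus holds because weight can be moved between two non-adjacent vertices, in one of the
  two directions, without decreasing the quadratic form, until the support is a clique.
\<close>

section \<open>The Motzkin--Straus inequality\<close>

text \<open>Along \<open>d\<close>, which moves weight from \<open>i\<close> to \<open>j\<close>,
  the form is affine in \<open>t\<close>: the quadratic coefficient is
  \<open>a j j - a j i - a i j + a i i\<close>, which vanishes. Hence the sign of the slope alone
  decides which direction does not decrease the form.\<close>

lemma quadratic_form_shift:
  fixes a :: "'a \<Rightarrow> 'a \<Rightarrow> real" and y :: "'a \<Rightarrow> real"
  assumes fin: "finite V" and i: "i \<in> V" and j: "j \<in> V"
    and sym: "\<And>u v. a u v = a v u"
    and zero: "a i i = 0" "a j j = 0" "a i j = 0"
  defines "d \<equiv> \<lambda>v. of_bool (v = j) - of_bool (v = i)"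
  shows "(\<Sum>u\<in>V. \<Sum>v\<in>V. a u v * (y u + t * d u) * (y v + t * d v)) =
    (\<Sum>u\<in>V. \<Sum>v\<in>V. a u v * y u * y v) +
      2 * t * ((\<Sum>v\<in>V. a j v * y v) - (\<Sum>v\<in>V. a i v * y v))"
proof -
  define B where "B f g = (\<Sum>u\<in>V. \<Sum>v\<in>V. a u v * f u * g v)" for f g :: "'a \<Rightarrow> real"
  have d_sum: "(\<Sum>u\<in>V. f u * d u) = f j - f i" for f
  proof -
    have "f u * d u = (if u = j then f u else 0) - (if u = i then f u else 0)" for u
      by (simp add: d_def)
    then show ?thesis using fin i j by (simp add: sum_subtractf)
  qed
  have Bd: "B d g = (\<Sum>v\<in>V. a j v * g v) - (\<Sum>v\<in>V. a i v * g v)" for g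
  proof -
    have "B d g = (\<Sum>u\<in>V. (\<Sum>v\<in>V. a u v * g v) * d u)"
      unfolding B_def sum_distrib_right by (intro sum.cong refl) (simp add: mult_ac)
    then show ?thesis by (simp add: d_sum)
  qed
  have B_sym: "B f g = B g f" for f g
    unfolding B_def by (subst sum.swap) (simp add: sym mult_ac)
  have dd: "B d d = 0"
    by (simp add: Bd d_sum zero sym[of j i])
  have "(\<Sum>u\<in>V. \<Sum>v\<in>V. a u v * (y u + t * d u) * (y v + t * d v)) =
      B y y + t * B d y + t * B y d + t\<^sup>2 * B d d"
    by (simp add: B_def algebra_simps sum.distrib sum_distrib_left power2_eq_square)
  also have "\<dots> = B y y + 2 * t * B d y"
    by (simp add: dd B_sym[of y d])
  finally show ?thesis by (simp add: Bd) (simp add: B_def)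
qed

text \<open>On a clique the form is the square of the sum minus the sum of squares, and
  Cauchy--Schwarz bounds the sum of squares from below.\<close>

lemma motzkin_straus_complete:
  fixes y :: "'a \<Rightarrow> real"
  assumes fin: "finite C" and card: "card C \<le> w"
  shows "(\<Sum>u\<in>C. \<Sum>v\<in>C. of_bool (u \<noteq> v) * y u * y v) \<le> (1 - 1 / real w) * (\<Sum>v\<in>C. y v)\<^sup>2"
proof (cases "C = {}")
  case False
  then have w: "0 < real w" using fin card by (cases w) auto
  have row: "(\<Sum>v\<in>C. of_bool (u \<noteq> v) * y u * y v) = y u * (\<Sum>v\<in>C. y v) - (y u)\<^sup>2"
    if "u \<in> C" for u
    using fin that by (simp add: sum.remove[OF fin that] sum_distrib_left power2_eq_square
        algebra_simps) (auto intro!: sum.cong)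
  have "(\<Sum>v\<in>C. y v)\<^sup>2 \<le> (\<Sum>v\<in>C. (y v)\<^sup>2) * real (card C)"
    by (rule sum_squared_le_sum_of_squares)
  also have "\<dots> \<le> (\<Sum>v\<in>C. (y v)\<^sup>2) * real w"
    using card by (intro mult_left_mono sum_nonneg) auto
  finally have "(\<Sum>v\<in>C. y v)\<^sup>2 / real w \<le> (\<Sum>v\<in>C. (y v)\<^sup>2)"
    using w by (simp add: divide_le_eq)
  moreover have "(\<Sum>u\<in>C. \<Sum>v\<in>C. of_bool (u \<noteq> v) * y u * y v) =
      (\<Sum>v\<in>C. y v)\<^sup>2 - (\<Sum>v\<in>C. (y v)\<^sup>2)"
    by (simp add: row sum_subtractf power2_eq_square flip: sum_distrib_right cong: sum.cong)
  ultimately show ?thesis by (simp add: algebra_simps)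
qed simp

text \<open>Both sides are homogeneous of degree two, so the weights need not be normalised to total
  1. The induction is on the size of the support.\<close>

theorem motzkin_straus:
  fixes y :: "'a \<Rightarrow> real"
  assumes fin: "finite V"
    and sym: "\<And>u v. E u v \<Longrightarrow> E v u" and irrefl: "\<And>v. \<not> E v v"
    and clique: "\<And>C. C \<subseteq> V \<Longrightarrow> pairwise E C \<Longrightarrow> card C \<le> w"
    and nonneg: "\<And>v. v \<in> V \<Longrightarrow> 0 \<le> y v"
  shows "(\<Sum>u\<in>V. \<Sum>v\<in>V. of_bool (E u v) * y u * y v) \<le> (1 - 1 / real w) * (\<Sum>v\<in>V. y v)\<^sup>2"
  using nonneg
proof (induction "card {v \<in> V. y v \<noteq> 0}" arbitrary: y rule: less_induct)
  case less
  define C where "C = {v \<in> V. y v \<noteq> 0}"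
  have C: "C \<subseteq> V" "finite C" using fin by (auto simp: C_def)
  show ?case
  proof (cases "pairwise E C")
    case True
    \<comment> \<open>Summands outside the support vanish, so every sum may be restricted to
      \<open>C\<close>.\<close>
    have sum_C: "(\<Sum>v\<in>V. f v) = (\<Sum>v\<in>C. f v)" if "\<And>v. y v = 0 \<Longrightarrow> f v = 0" for f :: "'a \<Rightarrow> real"
      using fin that by (intro sum.mono_neutral_right) (auto simp: C_def)
    have "(\<Sum>u\<in>V. \<Sum>v\<in>V. of_bool (E u v) * y u * y v) =
        (\<Sum>u\<in>C. \<Sum>v\<in>C. of_bool (E u v) * y u * y v)"
      by (simp add: sum_C)
    also have "\<dots> = (\<Sum>u\<in>C. \<Sum>v\<in>C. of_bool (u \<noteq> v) * y u * y v)"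
      using True irrefl by (intro sum.cong refl) (auto simp: pairwise_def of_bool_def)
    also have "\<dots> \<le> (1 - 1 / real w) * (\<Sum>v\<in>C. y v)\<^sup>2"
      using C True by (intro motzkin_straus_complete clique)
    finally show ?thesis by (simp add: sum_C)
  next
    case False
    \<comment> \<open>\<open>r u\<close> is half the partial derivative of the form at
      \<open>u\<close>. The two vertices are named so that moving weight from \<open>i\<close> to
      \<open>j\<close> has nonnegative slope.\<close>
    define r where "r u = (\<Sum>v\<in>V. of_bool (E u v) * y v)" for u
    obtain i j where ij: "i \<in> C" "j \<in> C" "i \<noteq> j" "\<not> E i j" "r i \<le> r j"
    proof -
      obtain i j where "i \<in> C" "j \<in> C" "i \<noteq> j" "\<not> E i j"
        using False by (auto simp: pairwise_def)
      then show ?thesis using that[of i j] that[of j i] sym by (cases "r i \<le> r j") auto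
    qed
    then have iV: "i \<in> V" "y i \<noteq> 0" and jV: "j \<in> V" "y j \<noteq> 0" by (auto simp: C_def)
    \<comment> \<open>The shift with \<open>t = y i\<close>: all weight of \<open>i\<close> goes to
      \<open>j\<close>. Then \<open>i\<close> leaves the support, \<open>j\<close> was already in
      it, and the total weight is unchanged.\<close>
    define z where "z v = y v + y i * (of_bool (v = j) - of_bool (v = i))" for v
    have "{v \<in> V. z v \<noteq> 0} \<subset> C"
      using ij iV jV by (auto simp: C_def z_def split: if_splits)
    then have "card {v \<in> V. z v \<noteq> 0} < card {v \<in> V. y v \<noteq> 0}"
      unfolding C_def[symmetric] using C(2) by (rule psubset_card_mono[rotated])
    moreover have "0 \<le> z v" if "v \<in> V" for v
      using less.prems[OF that] less.prems[OF iV(1)] by (auto simp: z_def)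
    ultimately have IH: "(\<Sum>u\<in>V. \<Sum>v\<in>V. of_bool (E u v) * z u * z v)
        \<le> (1 - 1 / real w) * (\<Sum>v\<in>V. z v)\<^sup>2"
      by (rule less.hyps)
    have "(\<Sum>u\<in>V. \<Sum>v\<in>V. of_bool (E u v) * z u * z v) =
        (\<Sum>u\<in>V. \<Sum>v\<in>V. of_bool (E u v) * y u * y v) + 2 * y i * (r j - r i)"
      unfolding z_def r_def
      using fin iV jV ij irrefl sym
      by (intro quadratic_form_shift) (auto simp: of_bool_def)
    moreover have "0 \<le> 2 * y i * (r j - r i)"
      using ij less.prems[OF iV(1)] by simp
    moreover have "(\<Sum>v\<in>V. z v) = (\<Sum>v\<in>V. y v)"
      using fin iV jV by (simp add: z_def sum.distrib sum_subtractf of_bool_def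
          flip: sum_distrib_left)
    ultimately show ?thesis using IH by simp
  qed
qed

section \<open>Eigenvalues of real symmetric matrices\<close>

text \<open>Over the complex numbers an eigenvalue exists; the matrix is Hermitian, so this
  eigenvalue is real and hence a root of the real characteristic polynomial.\<close>

lemma symmetric_real_mat_eigenvalue:
  fixes A :: "real mat"
  assumes A: "A \<in> carrier_mat n n" and n: "0 < n" and sym: "A\<^sup>T = A"
  obtains k where "eigenvalue A k"
proof -
  let ?A = "map_mat complex_of_real A"
  have cA: "?A \<in> carrier_mat n n" using A by simp
  obtain k where "eigenvalue ?A k"
    using spectrum_non_empty[OF cA n] by (auto simp: spectrum_def)
  then obtain v where v: "v \<in> carrier_vec n" "v \<noteq> 0\<^sub>v n" "?A *\<^sub>v v = k \<cdot>\<^sub>v v"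
    using cA by (auto simp: eigenvalue_def eigenvector_def)
  have conj: "?A *\<^sub>v conjugate v = conjugate (?A *\<^sub>v v)"
    using A v(1) by (intro eq_vecI) (auto simp: scalar_prod_def)
  have symA: "?A\<^sup>T = ?A" using sym by (metis map_mat_transpose)
  \<comment> \<open>The Hermitian product of \<open>?A *\<^sub>v v\<close> with \<open>v\<close> is
    evaluated twice: directly, and with the matrix moved to \<open>conjugate v\<close>, where it
    acts as \<open>cnj k\<close>.\<close>
  have "k * (v \<bullet>c v) = (?A *\<^sub>v v) \<bullet>c v"
    using v by simp
  also have "\<dots> = v \<bullet> (?A *\<^sub>v conjugate v)"
    using transpose_vec_mult_scalar[OF cA, of "conjugate v" v] v symA by simp
  also have "\<dots> = cnj k * (v \<bullet>c v)"
    using v by (simp add: conj conjugate_smult_vec)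
  finally have "k = cnj k" using v by simp
  then have k: "k = complex_of_real (Re k)" by (simp add: complex_eq_iff)
  have "poly (char_poly ?A) (complex_of_real (Re k)) = 0"
    using \<open>eigenvalue ?A k\<close> k eigenvalue_root_char_poly[OF cA] by metis
  then have "poly (char_poly A) (Re k) = 0"
    using A by (simp add: of_real_hom.char_poly_hom)
  then show thesis using that eigenvalue_root_char_poly[OF A] by blast
qed

text \<open>Symmetry matters here: without a real root, \<open>eigval 1 A\<close> would be an entry of the empty list.\<close>

lemma eigenvalue_eigval_1:
  assumes A: "A \<in> carrier_mat n n" and n: "0 < n" and sym: "A\<^sup>T = A"
  shows "eigenvalue A (eigval 1 A)"
proof -
  \<comment> \<open>Only for a nonzero polynomial does \<open>proots\<close> collect exactly the
    roots.\<close>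
  have p0: "char_poly A \<noteq> 0"
    using degree_monic_char_poly[OF A] n by auto
  have set: "set (eigvals_desc A) = {k. eigenvalue A k}"
    using p0 eigenvalue_root_char_poly[OF A] by (auto simp: eigvals_desc_def)
  obtain k where "eigenvalue A k"
    using symmetric_real_mat_eigenvalue[OF A n sym] .
  then have "eigvals_desc A \<noteq> []" using set by force
  then have "eigval 1 A \<in> set (eigvals_desc A)" by (simp add: eigval_def)
  then show ?thesis using set by simp
qed

section \<open>Cliques and degrees\<close>

text \<open>Passes from a clique as a vertex set to the subgraph it induces, which is what
  \<open>clique_number\<close> measures.\<close>

lemma (in graph) card_clique_le_clique_number:
  assumes C: "C \<subseteq> verts G" and clique: "pairwise (\<lambda>u v. (u, v) \<in> arcs_ends G) C"
  shows "card C \<le> clique_number G"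
proof -
  let ?K = "{k. \<exists>H. subgraph H G \<and> complete_digraph k H}"
  \<comment> \<open>Bounded sizes make the set finite, so that its \<open>Max\<close> is an upper
    bound.\<close>
  have "k \<le> card (verts G)" if "k \<in> ?K" for k
    using that by (auto simp: complete_digraph_def subgraph_def intro: card_mono)
  then have fin: "finite ?K" by (meson finite_nat_set_iff_bounded_le)
  let ?H = "G \<restriction> C"
  \<comment> \<open>The clique hypothesis supplies all pairs of distinct vertices; the absence of
    loops excludes the diagonal.\<close>
  have ends: "arcs_ends ?H = {(u, v). (u, v) \<in> C \<times> C \<and> u \<noteq> v}"
    using clique no_loops
    by (fastforce simp: arcs_ends_def arc_to_ends_def pairwise_def image_iff)
  have wf: "wf_digraph ?H" by (rule wellformed_induce_subgraph)
  interpret H: wf_digraph ?H by (rule wf)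
  have "graph ?H"
  proof unfold_locales
    show "finite (verts ?H)" using C by (auto intro: finite_subset)
    show "symmetric ?H" by (auto simp: symmetric_def ends sym_def)
  qed (use no_loops no_multi_arcs in \<open>auto simp: arc_to_ends_def\<close>)
  moreover have "subgraph ?H G"
    using C wf wf_digraph_axioms by (auto simp: subgraph_def compatible_def)
  ultimately have "card C \<in> ?K" using ends by (auto simp: complete_digraph_def)
  then show ?thesis unfolding clique_number_def using fin by simp
qed

lemma (in fin_digraph) out_degree_le_max_degree:
  "v \<in> verts G \<Longrightarrow> out_degree G v \<le> max_degree G"
  by (simp add: max_degree_def)

section \<open>The bound\<close>

lemma A_alpha_carrier: "A_alpha \<alpha> G vs \<in> carrier_mat (length vs) (length vs)"
  by (simp add: A_alpha_def adjacency_mat_def degree_mat_def mat_diag_def)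

lemma A_alpha_index:
  assumes "i < length vs" "j < length vs"
  shows "A_alpha \<alpha> G vs $$ (i, j) = \<alpha> * (if i = j then real (out_degree G (vs ! i)) else 0) +
    (1 - \<alpha>) * of_bool ((vs ! i, vs ! j) \<in> arcs_ends G)"
  using assms by (auto simp: A_alpha_def adjacency_mat_def degree_mat_def mat_diag_def)

lemma (in graph) arcs_ends_sym: "(u, v) \<in> arcs_ends G \<Longrightarrow> (v, u) \<in> arcs_ends G"
  using sym_arcs by (auto simp: symmetric_def dest: symD)

lemma (in graph) A_alpha_transpose: "(A_alpha \<alpha> G vs)\<^sup>T = A_alpha \<alpha> G vs"
proof (rule eq_matI)
  fix i j assume "i < dim_row (A_alpha \<alpha> G vs)" "j < dim_col (A_alpha \<alpha> G vs)"
  then show "(A_alpha \<alpha> G vs)\<^sup>T $$ (i, j) = A_alpha \<alpha> G vs $$ (i, j)"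
    using A_alpha_carrier[of \<alpha> G vs] arcs_ends_sym by (auto simp: A_alpha_index of_bool_def)
qed (use A_alpha_carrier[of \<alpha> G vs] in auto)

text \<open>Motzkin--Straus is applied to positions in \<open>vs\<close>, which index the vectors.
  As \<open>vs\<close> is distinct, a clique of positions maps to a clique of \<open>G\<close> of
  the same size.\<close>

lemma (in graph) adjacency_form_le:
  fixes x :: "nat \<Rightarrow> real"
  assumes vs: "distinct vs" "set vs = verts G" and len: "length vs = n"
    and w: "1 \<le> clique_number G"
  shows "(\<Sum>i<n. \<Sum>j<n. of_bool ((vs ! i, vs ! j) \<in> arcs_ends G) * x i * x j)
    \<le> (1 - 1 / real (clique_number G)) * real n * (\<Sum>i<n. (x i)\<^sup>2)"
proof -
  define E where "E i j \<longleftrightarrow> (vs ! i, vs ! j) \<in> arcs_ends G" for i j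
  have card: "card C \<le> clique_number G" if C: "C \<subseteq> {..<n}" "pairwise E C" for C
  proof -
    have "inj_on ((!) vs) C"
      using C(1) vs(1) len by (auto intro: inj_on_nth)
    then have "card C = card ((!) vs ` C)" by (simp add: card_image)
    also have "\<dots> \<le> clique_number G"
      using C len
      by (intro card_clique_le_clique_number) (auto simp: pairwise_def E_def simp flip: vs(2))
    finally show ?thesis .
  qed
  have "(\<Sum>i<n. \<Sum>j<n. of_bool (E i j) * x i * x j)
      \<le> (\<Sum>i<n. \<Sum>j<n. of_bool (E i j) * \<bar>x i\<bar> * \<bar>x j\<bar>)"
    by (intro sum_mono) (auto simp: of_bool_def simp flip: abs_mult)
  also have "\<dots> \<le> (1 - 1 / real (clique_number G)) * (\<Sum>i<n. \<bar>x i\<bar>)\<^sup>2"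
  proof (rule motzkin_straus)
    show "\<not> E i i" for i
      using no_loops by (fastforce simp: E_def arcs_ends_def arc_to_ends_def)
    show "E j i" if "E i j" for i j
      using that arcs_ends_sym by (simp add: E_def)
  qed (use card in auto)
  \<comment> \<open>Cauchy--Schwarz, multiplied by a factor that is nonnegative because the clique
    number is at least 1.\<close>
  also have "\<dots> \<le> (1 - 1 / real (clique_number G)) * (real n * (\<Sum>i<n. (x i)\<^sup>2))"
  proof (rule mult_left_mono)
    show "(\<Sum>i<n. \<bar>x i\<bar>)\<^sup>2 \<le> real n * (\<Sum>i<n. (x i)\<^sup>2)"
      using sum_squared_le_sum_of_squares[of "\<lambda>i. \<bar>x i\<bar>" "{..<n}"] by (simp add: mult.commute)
  qed (use w in simp)
  finally show ?thesis by (simp add: E_def mult.assoc)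
qed

theorem theorem3p6:
  fixes G :: "('a, 'b) pre_digraph" and vs :: "'a list" and \<alpha> :: real and n :: nat
  assumes "graph G"
    and "card (verts G) = n" and "n \<ge> 1"
    and "distinct vs" and "set vs = verts G"
    and "0 \<le> \<alpha>" and "\<alpha> \<le> 1"
  shows "eigval 1 (A_alpha \<alpha> G vs)
    \<le> \<alpha> * real (max_degree G) + (1 - \<alpha>) * (1 - 1 / real (clique_number G)) * real n"
proof -
  interpret graph G by fact
  let ?A = "A_alpha \<alpha> G vs" and ?k = "eigval 1 (A_alpha \<alpha> G vs)"
  have len: "length vs = n" using assms distinct_card by metis
  have A: "?A \<in> carrier_mat n n" using A_alpha_carrier[of \<alpha> G vs] len by simp
  have "eigenvalue ?A ?k"
    using A A_alpha_transpose \<open>n \<ge> 1\<close> by (intro eigenvalue_eigval_1) auto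
  then obtain x where x: "x \<in> carrier_vec n" "x \<noteq> 0\<^sub>v n" "?A *\<^sub>v x = ?k \<cdot>\<^sub>v x"
    using A by (auto simp: eigenvalue_def eigenvector_def)
  define N where "N = (\<Sum>i<n. (x $ i)\<^sup>2)"
  have "\<exists>i<n. x $ i \<noteq> 0" using x(1,2) by (metis carrier_vecD eq_vecI index_zero_vec)
  then have N: "0 < N" unfolding N_def by (auto intro: sum_pos2)
  \<comment> \<open>A single vertex is already a clique.\<close>
  obtain v where "v \<in> verts G" using assms(2,3) by fastforce
  then have w: "1 \<le> clique_number G" using card_clique_le_clique_number[of "{v}"] by simp

  \<comment> \<open>Coordinate \<open>i\<close> of the eigenvector equation, with the diagonal
    degree term split off.\<close>
  have row: "?k * x $ i = \<alpha> * real (out_degree G (vs ! i)) * x $ i +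
      (1 - \<alpha>) * (\<Sum>j<n. of_bool ((vs ! i, vs ! j) \<in> arcs_ends G) * x $ j)" if i: "i < n" for i
  proof -
    have "?k * x $ i = (?A *\<^sub>v x) $ i" using x i by simp
    also have "\<dots> = (\<Sum>j<n. ?A $$ (i, j) * x $ j)"
      using A x(1) i by (simp add: scalar_prod_def atLeast0LessThan)
    also have "\<dots> = (\<Sum>j<n. (if i = j then \<alpha> * real (out_degree G (vs ! i)) * x $ i else 0) +
        (1 - \<alpha>) * (of_bool ((vs ! i, vs ! j) \<in> arcs_ends G) * x $ j))"
      using i len by (intro sum.cong) (auto simp: A_alpha_index algebra_simps)
    finally show ?thesis
      using i by (simp add: sum.distrib flip: sum_distrib_left del: sum_mult_of_bool_eq)
  qed
  \<comment> \<open>Multiplying each coordinate equation by \<open>x $ i\<close> and summing gives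
    the Rayleigh identity; the positive factor \<open>N\<close> is cancelled at the end.\<close>
  have "?k * N = (\<Sum>i<n. x $ i * (?k * x $ i))"
    by (simp add: N_def sum_distrib_left power2_eq_square mult_ac)
  also have "\<dots> = (\<Sum>i<n. \<alpha> * real (out_degree G (vs ! i)) * (x $ i)\<^sup>2) + (1 - \<alpha>) *
      (\<Sum>i<n. \<Sum>j<n. of_bool ((vs ! i, vs ! j) \<in> arcs_ends G) * x $ i * x $ j)"
    unfolding sum_distrib_left sum.distrib[symmetric]
    by (intro sum.cong refl, subst row)
      (simp_all add: sum_distrib_left power2_eq_square distrib_left mult_ac
        del: sum_mult_of_bool_eq)
  also have "\<dots> \<le> \<alpha> * real (max_degree G) * N +
      (1 - \<alpha>) * ((1 - 1 / real (clique_number G)) * real n * N)"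
  proof (rule add_mono)
    have "out_degree G (vs ! i) \<le> max_degree G" if "i < n" for i
      using that len assms(5) nth_mem[of i vs] by (intro out_degree_le_max_degree) simp
    then show "(\<Sum>i<n. \<alpha> * real (out_degree G (vs ! i)) * (x $ i)\<^sup>2) \<le> \<alpha> * real (max_degree G) * N"
      unfolding N_def sum_distrib_left
      using assms(6) by (intro sum_mono mult_right_mono mult_left_mono) simp_all
    show "(1 - \<alpha>) * (\<Sum>i<n. \<Sum>j<n. of_bool ((vs ! i, vs ! j) \<in> arcs_ends G) * x $ i * x $ j)
        \<le> (1 - \<alpha>) * ((1 - 1 / real (clique_number G)) * real n * N)"
      unfolding N_def using assms(4,5,7) len w
      by (intro mult_left_mono adjacency_form_le) auto
  qed
  also have "\<dots> =
      (\<alpha> * real (max_degree G) + (1 - \<alpha>) * (1 - 1 / real (clique_number G)) * real n) * N"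
    by (simp add: algebra_simps)
  finally show ?thesis using N by simp
qed

end
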